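(* Let $R$ be a ring with the ascending chain condition on (two-sided) ideals and let $S\subseteq R$ be a subring such that $(S/P)\cap U(R/P)=U(S/P)$ for all prime ideals $P$ of $R$. Then $S\cap U(R)=U(S)$.
   Context: All rings are associative with identity (not necessarily commutative), and every subring contains the identity of the larger ring. $U(\cdot)$ denotes the group of units of a ring. For a two-sided ideal $P$ of $R$ and a subring $S\subseteq R$, $S/P$ denotes the subring $\{s+P\mid s\in S\}$ of the factor ring $R/P$ ($P$ is not assumed to be contained in $S$). *)

theory Defs
  imports "HOL-Algebra.Subrings" "HOL-Algebra.QuotRing" "HOL-Algebra.Ideal_Product"
begin

text \<open>
  The library locale \<^locale>\<open>primeideal\<close> extends \<^locale>\<open>cring\<close> and tests primality on
  elements. Over a ring that need not be commutative, primality is tested on products of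
  two-sided ideals.
\<close>

definition nc_prime_ideal :: "'a set \<Rightarrow> ('a, 'b) ring_scheme \<Rightarrow> bool"
  where "nc_prime_ideal P R \<longleftrightarrow>
    ideal P R \<and> P \<noteq> carrier R \<and>
    (\<forall>I J. ideal I R \<longrightarrow> ideal J R \<longrightarrow> I \<cdot>\<^bsub>R\<^esub> J \<subseteq> P \<longrightarrow> I \<subseteq> P \<or> J \<subseteq> P)"

text \<open>
  The library's \<open>noetherian_ring\<close> states finite generation of ideals rather than the
  chain condition.
\<close>

definition acc_ideals :: "('a, 'b) ring_scheme \<Rightarrow> bool"
  where "acc_ideals R \<longleftrightarrow>
    (\<forall>I :: nat \<Rightarrow> 'a set. (\<forall>n. ideal (I n) R) \<and> (\<forall>n. I n \<subseteq> I (Suc n)) \<longrightarrow>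
      (\<exists>N. \<forall>n\<ge>N. I n = I N))"

text \<open>
  \<open>S/P\<close> is the image of \<open>S\<close> in \<open>R/P\<close>, with the operations of \<open>R/P\<close>. It is not
  the library quotient of the ring \<open>S\<close> by \<open>P\<close>, since \<open>P\<close> need not be contained in \<open>S\<close>.
\<close>

definition subring_quot :: "('a, 'b) ring_scheme \<Rightarrow> 'a set \<Rightarrow> 'a set \<Rightarrow> 'a set ring"
  where "subring_quot R S P = (R Quot P)\<lparr>carrier := {P +>\<^bsub>R\<^esub> s | s. s \<in> S}\<rparr>"

end

theory Submission
  imports Defs
begin

text \<open>
  Let \<open>s \<in> S\<close> be a unit of \<open>R\<close>. Call an ideal \<open>I\<close> good if \<open>s\<close> has a right inverse modulo \<open>I\<close> that
  lies in \<open>S\<close>, that is, if \<open>1 - s t \<in> I\<close> for some \<open>t \<in> S\<close>. The improper ideal is good, and the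
  hypothesis on \<open>S/P\<close> makes every prime ideal good. Goodness also passes to products:
  if \<open>1 - s a \<in> J\<close> and \<open>1 - s b \<in> K\<close>, then the product \<open>(1 - s a)(1 - s b)\<close> lies in \<open>J K\<close>
  and is again of the form \<open>1 - s t\<close>, with \<open>t = a + b - a s b\<close> in \<open>S\<close>.

  By the chain condition, every ideal contains a product of finitely many ideals that are prime
  or improper; here this is phrased as the induction principle \<open>prime_product_induct\<close>. Hence
  the zero ideal is good, so \<open>s t = 1\<close> for some \<open>t \<in> S\<close>. As \<open>s\<close> is a unit of \<open>R\<close>, this \<open>t\<close> is
  its inverse.
\<close>

lemma acc_ideals_induct [consumes 2, case_names larger]:
  assumes acc: "acc_ideals R"
    and "ideal I R"
    and step: "\<And>I. ideal I R \<Longrightarrow> (\<And>J. ideal J R \<Longrightarrow> I \<subset> J \<Longrightarrow> Q J) \<Longrightarrow> Q I"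
  shows "Q I"
proof -
  define above where "above = {(J, I). ideal J R \<and> ideal I R \<and> I \<subset> J}"
  have "wf above"
    unfolding wf_iff_no_infinite_down_chain
  proof
    assume "\<exists>f. \<forall>n. (f (Suc n), f n) \<in> above"
    then obtain f where f: "\<forall>n. (f (Suc n), f n) \<in> above" ..
    then have "\<forall>n. ideal (f n) R" "\<forall>n. f n \<subseteq> f (Suc n)"
      by (auto simp: above_def)
    with acc obtain N where N: "\<forall>n\<ge>N. f n = f N"
      unfolding acc_ideals_def by presburger
    have "f (Suc N) = f N"
      by (rule N[rule_format]) simp
    moreover have "f N \<subset> f (Suc N)"
      using f by (simp add: above_def)
    ultimately show False
      by simp
  qed
  then show ?thesis
    using \<open>ideal I R\<close>
  proof (induction I rule: wf_induct_rule)
    case (less I)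
    show ?case
    proof (rule step[OF less.prems])
      fix J
      assume "ideal J R" "I \<subset> J"
      then show "Q J"
        using less by (simp add: above_def)
    qed
  qed
qed

text \<open>
  Modulo \<open>I\<close>, adding \<open>I\<close> to both factors changes nothing: in
  \<open>(i + j)(i' + k) = i (i' + k) + (j i' + j k)\<close> every summand except \<open>j k\<close> has a factor in \<open>I\<close>.
  This serves to replace two ideals outside \<open>I\<close> by two ideals strictly above \<open>I\<close>.
\<close>

lemma (in ring) sum_ideals_prod_subset:
  assumes I: "ideal I R" and J: "ideal J R" and K: "ideal K R"
    and JK: "J \<cdot> K \<subseteq> I"
  shows "(I <+> J) \<cdot> (I <+> K) \<subseteq> I"
proof
  interpret I: ideal I R by (rule I)
  interpret J: ideal J R by (rule J)
  interpret K: ideal K R by (rule K)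
  fix z
  assume "z \<in> (I <+> J) \<cdot> (I <+> K)"
  then show "z \<in> I"
  proof (induction z rule: ideal_prod.induct)
    case (prod x y)
    from \<open>x \<in> I <+> J\<close> obtain i j where x: "i \<in> I" "j \<in> J" "x = i \<oplus> j"
      by (auto simp: set_add_def')
    from \<open>y \<in> I <+> K\<close> obtain i' k where y: "i' \<in> I" "k \<in> K" "y = i' \<oplus> k"
      by (auto simp: set_add_def')
    have carr: "i \<in> carrier R" "i' \<in> carrier R" "j \<in> carrier R" "k \<in> carrier R"
      using x y I.Icarr J.Icarr K.Icarr by auto
    have "j \<otimes> k \<in> I"
      using x y by (intro subsetD[OF JK] ideal_prod.prod)
    moreover have "i \<otimes> y \<in> I" "j \<otimes> i' \<in> I"
      using x y carr I.I_r_closed I.I_l_closed by simp_all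
    moreover have "x \<otimes> y = i \<otimes> y \<oplus> (j \<otimes> i' \<oplus> j \<otimes> k)"
      using carr x(3) y(3) by (simp add: l_distr r_distr a_ac)
    ultimately show ?case
      by (simp add: I.a_closed)
  next
    case (sum z1 z2)
    then show ?case
      by simp
  qed
qed

text \<open>
  This is the statement that every ideal contains a finite product of ideals that are prime or
  improper, phrased so that no products of lists of ideals are needed. It is Noetherian induction:
  an ideal \<open>I\<close> that is neither prime nor improper contains \<open>J K\<close> for ideals \<open>J\<close> and \<open>K\<close> not
  contained in \<open>I\<close>, and \<open>I + J\<close> and \<open>I + K\<close> are strictly larger ideals whose product still lies
  in \<open>I\<close>.
\<close>

lemma (in ring) prime_product_induct [consumes 2, case_names carrier prime prod]:
  assumes acc: "acc_ideals R"
    and "ideal I R"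
    and carrier: "Q (carrier R)"
    and prime: "\<And>P. nc_prime_ideal P R \<Longrightarrow> Q P"
    and prod: "\<And>I J K. ideal I R \<Longrightarrow> ideal J R \<Longrightarrow> ideal K R \<Longrightarrow> J \<cdot> K \<subseteq> I \<Longrightarrow> Q J \<Longrightarrow> Q K \<Longrightarrow> Q I"
  shows "Q I"
  using acc \<open>ideal I R\<close>
proof (induction I rule: acc_ideals_induct)
  case (larger I)
  show ?case
  proof (cases "I = carrier R \<or> nc_prime_ideal I R")
    case True
    then show ?thesis
      using carrier prime by auto
  next
    case False
    then obtain J K where JK: "ideal J R" "ideal K R" "J \<cdot> K \<subseteq> I" "\<not> J \<subseteq> I" "\<not> K \<subseteq> I"
      using \<open>ideal I R\<close> unfolding nc_prime_ideal_def by blast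
    have strict: "ideal (I <+> L) R \<and> I \<subset> I <+> L" if "ideal L R" "\<not> L \<subseteq> I" for L
    proof -
      have "ideal (I <+> L) R" "I \<union> L \<subseteq> I <+> L"
        using add_ideals[OF \<open>ideal I R\<close> that(1)] union_genideal[OF \<open>ideal I R\<close> that(1)]
          genideal_self[of "I \<union> L"] \<open>ideal I R\<close> that(1)
        by (auto dest: ideal.Icarr)
      with that(2) show ?thesis
        by blast
    qed
    show ?thesis
    proof (rule prod)
      show "(I <+> J) \<cdot> (I <+> K) \<subseteq> I"
        using sum_ideals_prod_subset \<open>ideal I R\<close> JK by blast
    qed (use larger strict JK in auto)
  qed
qed

lemma (in ring) a_r_coset_eq_one_imp_diff_mem:
  assumes "ideal P R" "x \<in> carrier R" "P +> x = P +> \<one>"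
  shows "\<one> \<ominus> x \<in> P"
  using quotient_eq_iff_same_a_r_cos[OF assms(1) one_closed assms(2)] assms(3) by simp

lemma (in ring) Units_subring_quotE:
  assumes "ideal P R" "subring S R" "s \<in> S"
    and "P +> s \<in> Units (subring_quot R S P)"
  obtains t where "t \<in> S" "\<one> \<ominus> s \<otimes> t \<in> P"
proof -
  interpret P: ideal P R by fact
  have S: "S \<subseteq> carrier R"
    using subringE(1)[OF assms(2)] .
  obtain t where t: "t \<in> S" "(P +> s) \<otimes>\<^bsub>R Quot P\<^esub> (P +> t) = P +> \<one>"
    using assms(4) unfolding Units_def subring_quot_def FactRing_def by auto
  then have "P +> (s \<otimes> t) = P +> \<one>"
    using P.rcoset_mult_add S \<open>s \<in> S\<close> unfolding FactRing_def by auto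
  then have "\<one> \<ominus> s \<otimes> t \<in> P"
    using a_r_coset_eq_one_imp_diff_mem[OF assms(1)] S t(1) \<open>s \<in> S\<close> by (meson m_closed subsetD)
  with t(1) show thesis by (rule that)
qed

text \<open>
  The correction term \<open>a + b - a s b\<close> is built from \<open>a\<close>, \<open>b\<close> and \<open>s\<close> alone, so it stays in any
  subring that contains these. The elements \<open>1 - s t\<close> with \<open>t\<close> in that subring are therefore
  closed under multiplication.
\<close>

lemma (in ring) one_minus_mult:
  assumes "s \<in> carrier R" "a \<in> carrier R" "b \<in> carrier R"
  shows "(\<one> \<ominus> s \<otimes> a) \<otimes> (\<one> \<ominus> s \<otimes> b) = \<one> \<ominus> s \<otimes> (a \<oplus> b \<ominus> a \<otimes> s \<otimes> b)"
  using assms by (algebra, simp)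

text \<open>
  A right inverse modulo \<open>I\<close> suffices as the induction invariant, since a right inverse of a unit
  of \<open>R\<close> is its inverse.
\<close>

lemma (in ring) unit_has_right_inverse_in_subring:
  assumes "acc_ideals R" "subring S R"
    and quot: "\<And>P. nc_prime_ideal P R \<Longrightarrow>
      carrier (subring_quot R S P) \<inter> Units (R Quot P) \<subseteq> Units (subring_quot R S P)"
    and s: "s \<in> S" "s \<in> Units R"
  obtains t where "t \<in> S" "s \<otimes> t = \<one>"
proof -
  note S = subringE[OF \<open>subring S R\<close>]
  have sR: "s \<in> carrier R"
    using s by auto
  have "\<exists>t\<in>S. \<one> \<ominus> s \<otimes> t \<in> I" if "ideal I R" for I
    using \<open>acc_ideals R\<close> that
  proof (induction I rule: prime_product_induct)
    case carrier
    \<comment> \<open>The condition is vacuous here, so any element of \<open>S\<close> will do.\<close>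
    show ?case
      using S sR by (intro bexI[of _ \<one>]) auto
  next
    case (prime P)
    then interpret P: ideal P R
      by (simp add: nc_prime_ideal_def)
    interpret hom: ring_hom_ring R "R Quot P" "(+>) P"
      by (rule P.rcos_ring_hom_ring)
    have "P +> s \<in> Units (R Quot P)"
      using s sR unfolding Units_def
      by clarsimp (metis hom.hom_closed hom.hom_mult hom.hom_one)
    moreover have "P +> s \<in> carrier (subring_quot R S P)"
      using s by (auto simp: subring_quot_def)
    ultimately have "P +> s \<in> Units (subring_quot R S P)"
      using quot[OF prime] by blast
    then show ?case
      using Units_subring_quotE[OF P.ideal_axioms \<open>subring S R\<close>] s by blast
  next
    case (prod I J K)
    then obtain a b where ab: "a \<in> S" "b \<in> S" "\<one> \<ominus> s \<otimes> a \<in> J" "\<one> \<ominus> s \<otimes> b \<in> K"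
      by blast
    then have "(\<one> \<ominus> s \<otimes> a) \<otimes> (\<one> \<ominus> s \<otimes> b) \<in> I"
      by (intro subsetD[OF \<open>J \<cdot> K \<subseteq> I\<close>] ideal_prod.prod)
    then have "\<one> \<ominus> s \<otimes> (a \<oplus> b \<ominus> a \<otimes> s \<otimes> b) \<in> I"
      using one_minus_mult[of s a b] S(1) sR ab(1,2) by (metis subsetD)
    moreover have "a \<oplus> b \<ominus> a \<otimes> s \<otimes> b \<in> S"
      using S s ab by (simp add: a_minus_def)
    ultimately show ?case
      by blast
  qed
  then obtain t where t: "t \<in> S" "\<one> \<ominus> s \<otimes> t \<in> {\<zero>}"
    using zeroideal by blast
  then have "\<one> \<oplus> \<ominus> (s \<otimes> t) = \<zero>"
    by (simp add: a_minus_def)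
  moreover have "s \<otimes> t \<in> carrier R"
    using t(1) S(1) sR by auto
  ultimately have "s \<otimes> t = \<one>"
    using minus_equality[of \<one> "\<ominus> (s \<otimes> t)"] by simp
  with t(1) show thesis
    by (rule that)
qed

theorem theorem2p8:
  fixes R :: "('a, 'b) ring_scheme" and S :: "'a set"
  assumes "ring R"
    and "acc_ideals R"
    and "subring S R"
    and "\<And>P. nc_prime_ideal P R \<Longrightarrow>
      carrier (subring_quot R S P) \<inter> Units (R Quot P) = Units (subring_quot R S P)"
  shows "S \<inter> Units R = Units (R\<lparr>carrier := S\<rparr>)"
proof
  interpret ring R by fact
  have S: "S \<subseteq> carrier R"
    using subringE(1)[OF \<open>subring S R\<close>] .
  then show "Units (R\<lparr>carrier := S\<rparr>) \<subseteq> S \<inter> Units R"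
    by (auto simp: Units_def)
  show "S \<inter> Units R \<subseteq> Units (R\<lparr>carrier := S\<rparr>)"
  proof
    fix s
    assume "s \<in> S \<inter> Units R"
    then have s: "s \<in> S" "s \<in> Units R"
      by auto
    obtain t where t: "t \<in> S" "s \<otimes>\<^bsub>R\<^esub> t = \<one>\<^bsub>R\<^esub>"
      using unit_has_right_inverse_in_subring[OF assms(2,3) equalityD1[OF assms(4)] s] .
    then have "t = inv\<^bsub>R\<^esub> s"
      using s S inv_unique[of "inv\<^bsub>R\<^esub> s" s t] by auto
    then have "t \<otimes>\<^bsub>R\<^esub> s = \<one>\<^bsub>R\<^esub>"
      using s by simp
    with s t show "s \<in> Units (R\<lparr>carrier := S\<rparr>)"
      by (auto simp: Units_def)
  qed
qed

end
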